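(* (i) Let $\sigma$ be a continuously differentiable strategy converging to $\bar k$. If $\sigma$ is an equilibrium strategy, then the functions $v$ and $w$ defined by $$v(k)=\int_0^\infty\Big(\frac{\delta-\rho}{\pi+\delta-\rho}e^{-(\delta+\pi)t}+\frac{\pi}{\pi+\delta-\rho}e^{-\rho t}\Big)\ln\big(\sigma(\mathcal{K}(\sigma;t,k))\big)\,dt,$$ $$w(k)=\frac{\pi}{\pi+\delta-\rho}\int_0^\infty\big(-e^{-(\delta+\pi)t}+e^{-\rho t}\big)\ln\big(\sigma(\mathcal{K}(\sigma;t,k))\big)\,dt$$ satisfy the system $$\Big(f-\frac1{v'}\Big)v'-\ln(v')=\delta v-(\delta-\rho)w,\qquad \Big(f-\frac1{v'}\Big)w'=-\pi v+(\rho+\pi)w,\qquad (\mathrm{S})$$ with the boundary conditions $$v(\bar k)=\frac{\rho+\pi}{\rho(\delta+\pi)}\ln f(\bar k),\qquad w(\bar k)=\frac{\pi}{\rho(\delta+\pi)}\ln f(\bar k),\qquad (\mathrm{B})$$ and the strategy $\sigma$ is given by $\sigma(k)=1/v'(k)$. (ii) Conversely, let $v$ be a $C^2$ function such that the strategy $\sigma(k)=1/v'(k)$ converges to $\bar k$. If there exists a $C^1$ function $w$ such that $(v,w)$ satisfies the system (S) and the boundary conditions (B), then $\sigma$ is an equilibrium strategy converging to $\bar k$.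
   Context: Data. $\pi,\delta,\rho>0$ are constants with $\pi+\delta\neq\rho$. The utility is $u(c)=\ln c$, $c>0$, and the discount function is $$h(t)=\frac{\delta-\rho}{\pi+\delta-\rho}e^{-(\delta+\pi)t}+\frac{\pi}{\pi+\delta-\rho}e^{-\rho t}.$$ The production function $f$ is strictly increasing, concave and continuously differentiable, and positive (so that $\ln f$ is defined). State space and strategies. The variable $k$ ranges over an open interval $K\subseteq\mathbb{R}$ containing $\bar k$. A (Markov) strategy is a continuously differentiable function $\sigma:K\to(0,\infty)$. Its flow $\mathcal{K}(\sigma;t,k)$ is defined by $$\frac{\partial \mathcal{K}(\sigma;t,k)}{\partial t}=f(\mathcal{K}(\sigma;t,k))-\sigma(\mathcal{K}(\sigma;t,k)),\qquad \mathcal{K}(\sigma;0,k)=k.$$ That $\sigma$ converges to $\bar k$ means that $\mathcal{K}(\sigma;t,k)\to\bar k$ as $t\to\infty$ for initial values $k$ sufficiently close to $\bar k$; $K$ is understood to consist of such initial values, i.e. for every $k\in K$ the flow exists and stays in $K$ for all $t\ge0$ and converges to $\bar k$. Then $f(\bar k)=\sigma(\bar k)$. Standing convention: the integrals involved converge and their derivatives in $k$ can be computed by differentiating under the integral sign. Equilibrium. For $k\in K$ and $c>0$ put $$P_1(k,\sigma,c)=\ln c-\ln\sigma(k)+\int_0^\infty h(t)\,\frac{\sigma'(k_0(t))}{\sigma(k_0(t))}\,k_1(t)\,dt,$$ where $k_0(t)=\mathcal{K}(\sigma;t,k)$ and $k_1$ solves $$\frac{dk_1}{dt}=\big(f'(k_0(t))-\sigma'(k_0(t))\big)k_1(t),\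 t\ge0,\qquad k_1(0)=\sigma(k)-c.$$ A strategy $\sigma$ converging to $\bar k$ is an equilibrium strategy if for every $k\in K$, $\sigma(k)=\arg\max_{c>0}P_1(k,\sigma,c)$. *)

theory Defs
  imports "HOL-Analysis.Analysis"
begin

definition discount :: "real \<Rightarrow> real \<Rightarrow> real \<Rightarrow> real \<Rightarrow> real" where
  "discount \<pi> \<delta> \<rho> t =
     (\<delta> - \<rho>) / (\<pi> + \<delta> - \<rho>) * exp (- (\<delta> + \<pi>) * t) + \<pi> / (\<pi> + \<delta> - \<rho>) * exp (- \<rho> * t)"

definition production_function :: "real set \<Rightarrow> (real \<Rightarrow> real) \<Rightarrow> bool" where
  "production_function K f \<longleftrightarrow>
     strict_mono_on K f \<and> concave_on K f \<and> f C1_differentiable_on K \<and> (\<forall>k\<in>K. f k > 0)"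

definition strategy :: "real set \<Rightarrow> (real \<Rightarrow> real) \<Rightarrow> bool" where
  "strategy K \<sigma> \<longleftrightarrow> \<sigma> C1_differentiable_on K \<and> (\<forall>k\<in>K. \<sigma> k > 0)"

text \<open>Functions on the interval \<open>K\<close> are total HOL functions whose values outside \<open>K\<close> are
  irrelevant; a trajectory is therefore required to stay in \<open>K\<close> for all nonnegative times.\<close>

definition trajectory ::
  "(real \<Rightarrow> real) \<Rightarrow> real set \<Rightarrow> (real \<Rightarrow> real) \<Rightarrow> real \<Rightarrow> (real \<Rightarrow> real) \<Rightarrow> bool" where
  "trajectory f K \<sigma> k x \<longleftrightarrow> x 0 = k \<and>
     (\<forall>t\<ge>0. x t \<in> K \<and> (x has_real_derivative (f (x t) - \<sigma> (x t))) (at t within {0..}))"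

text \<open>The choice is immaterial on \<open>{0..}\<close>: for continuously differentiable \<open>f\<close> and \<open>\<sigma>\<close>
  trajectories are unique there. Existence is part of \<open>converges_to\<close> below.\<close>

definition flow ::
  "(real \<Rightarrow> real) \<Rightarrow> real set \<Rightarrow> (real \<Rightarrow> real) \<Rightarrow> real \<Rightarrow> real \<Rightarrow> real" where
  "flow f K \<sigma> t k = (SOME x. trajectory f K \<sigma> k x) t"

definition converges_to ::
  "(real \<Rightarrow> real) \<Rightarrow> real set \<Rightarrow> (real \<Rightarrow> real) \<Rightarrow> real \<Rightarrow> bool" where
  "converges_to f K \<sigma> kbar \<longleftrightarrow>
     (\<forall>k\<in>K. (\<exists>x. trajectory f K \<sigma> k x) \<and> ((\<lambda>t. flow f K \<sigma> t k) \<longlongrightarrow> kbar) at_top)"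

text \<open>The solution \<open>k\<^sub>1\<close> of the equation linearised along the trajectory through \<open>k\<close>; it exists
  and is unique on \<open>{0..}\<close>.\<close>

definition linearised_solution ::
  "(real \<Rightarrow> real) \<Rightarrow> real set \<Rightarrow> (real \<Rightarrow> real) \<Rightarrow> real \<Rightarrow> real \<Rightarrow> real \<Rightarrow> real" where
  "linearised_solution f K \<sigma> k c =
     (SOME k1. k1 0 = \<sigma> k - c \<and>
        (\<forall>t\<ge>0. (k1 has_real_derivative
            ((deriv f (flow f K \<sigma> t k) - deriv \<sigma> (flow f K \<sigma> t k)) * k1 t)) (at t within {0..})))"

definition P1 ::
  "real \<Rightarrow> real \<Rightarrow> real \<Rightarrow> (real \<Rightarrow> real) \<Rightarrow> real set \<Rightarrow> real \<Rightarrow> (real \<Rightarrow> real) \<Rightarrow> real \<Rightarrow> real" where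
  "P1 \<pi> \<delta> \<rho> f K k \<sigma> c = ln c - ln (\<sigma> k) +
     integral {0..} (\<lambda>t. discount \<pi> \<delta> \<rho> t * (deriv \<sigma> (flow f K \<sigma> t k) / \<sigma> (flow f K \<sigma> t k))
       * linearised_solution f K \<sigma> k c t)"

text \<open>\<open>\<sigma> k = argmax\<close> is read as: \<open>\<sigma> k\<close> is the one and only maximiser over \<open>c > 0\<close>.\<close>

definition equilibrium_strategy ::
  "real \<Rightarrow> real \<Rightarrow> real \<Rightarrow> (real \<Rightarrow> real) \<Rightarrow> real set \<Rightarrow> real \<Rightarrow> (real \<Rightarrow> real) \<Rightarrow> bool" where
  "equilibrium_strategy \<pi> \<delta> \<rho> f K kbar \<sigma> \<longleftrightarrow>
     strategy K \<sigma> \<and> converges_to f K \<sigma> kbar \<and>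
     (\<forall>k\<in>K. {c. is_arg_max (P1 \<pi> \<delta> \<rho> f K k \<sigma>) (\<lambda>c. c > 0) c} = {\<sigma> k})"

definition v_integrand ::
  "real \<Rightarrow> real \<Rightarrow> real \<Rightarrow> (real \<Rightarrow> real) \<Rightarrow> real set \<Rightarrow> (real \<Rightarrow> real) \<Rightarrow> real \<Rightarrow> real \<Rightarrow> real" where
  "v_integrand \<pi> \<delta> \<rho> f K \<sigma> k t = discount \<pi> \<delta> \<rho> t * ln (\<sigma> (flow f K \<sigma> t k))"

definition w_integrand ::
  "real \<Rightarrow> real \<Rightarrow> real \<Rightarrow> (real \<Rightarrow> real) \<Rightarrow> real set \<Rightarrow> (real \<Rightarrow> real) \<Rightarrow> real \<Rightarrow> real \<Rightarrow> real" where
  "w_integrand \<pi> \<delta> \<rho> f K \<sigma> k t =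
     (- exp (- (\<delta> + \<pi>) * t) + exp (- \<rho> * t)) * ln (\<sigma> (flow f K \<sigma> t k))"

definition v_integral ::
  "real \<Rightarrow> real \<Rightarrow> real \<Rightarrow> (real \<Rightarrow> real) \<Rightarrow> real set \<Rightarrow> (real \<Rightarrow> real) \<Rightarrow> real \<Rightarrow> real" where
  "v_integral \<pi> \<delta> \<rho> f K \<sigma> k = integral {0..} (v_integrand \<pi> \<delta> \<rho> f K \<sigma> k)"

definition w_integral ::
  "real \<Rightarrow> real \<Rightarrow> real \<Rightarrow> (real \<Rightarrow> real) \<Rightarrow> real set \<Rightarrow> (real \<Rightarrow> real) \<Rightarrow> real \<Rightarrow> real" where
  "w_integral \<pi> \<delta> \<rho> f K \<sigma> k =
     \<pi> / (\<pi> + \<delta> - \<rho>) * integral {0..} (w_integrand \<pi> \<delta> \<rho> f K \<sigma> k)"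

text \<open>The convention that an integral over \<open>{0..}\<close> depending on the parameter \<open>k\<close> converges and
  may be differentiated under the integral sign. For a Henstock--Kurzweil integral over \<open>{0..}\<close>,
  \<open>integrable_on\<close> is convergence as an improper integral.\<close>

definition differentiable_under_integral ::
  "real set \<Rightarrow> (real \<Rightarrow> real \<Rightarrow> real) \<Rightarrow> bool" where
  "differentiable_under_integral K F \<longleftrightarrow>
     (\<forall>k\<in>K. F k integrable_on {0..} \<and>
        (\<lambda>t. deriv (\<lambda>\<kappa>. F \<kappa> t) k) integrable_on {0..} \<and>
        ((\<lambda>\<kappa>. integral {0..} (F \<kappa>)) has_real_derivative
           integral {0..} (\<lambda>t. deriv (\<lambda>\<kappa>. F \<kappa> t) k)) (at k))"

text \<open>Differentiability and \<open>v' > 0\<close> are what makes \<open>v'\<close>, \<open>w'\<close>, \<open>1 / v'\<close> and \<open>ln v'\<close> meaningful.\<close>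

definition system_S ::
  "real \<Rightarrow> real \<Rightarrow> real \<Rightarrow> (real \<Rightarrow> real) \<Rightarrow> real set \<Rightarrow> (real \<Rightarrow> real) \<Rightarrow> (real \<Rightarrow> real) \<Rightarrow> bool" where
  "system_S \<pi> \<delta> \<rho> f K v w \<longleftrightarrow>
     (\<forall>k\<in>K. v field_differentiable at k \<and> w field_differentiable at k \<and> deriv v k > 0 \<and>
        (f k - 1 / deriv v k) * deriv v k - ln (deriv v k) = \<delta> * v k - (\<delta> - \<rho>) * w k \<and>
        (f k - 1 / deriv v k) * deriv w k = - \<pi> * v k + (\<rho> + \<pi>) * w k)"

definition boundary_B ::
  "real \<Rightarrow> real \<Rightarrow> real \<Rightarrow> (real \<Rightarrow> real) \<Rightarrow> real \<Rightarrow> (real \<Rightarrow> real) \<Rightarrow> (real \<Rightarrow> real) \<Rightarrow> bool" where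
  "boundary_B \<pi> \<delta> \<rho> f kbar v w \<longleftrightarrow>
     v kbar = (\<rho> + \<pi>) / (\<rho> * (\<delta> + \<pi>)) * ln (f kbar) \<and>
     w kbar = \<pi> / (\<rho> * (\<delta> + \<pi>)) * ln (f kbar)"

end

theory Submission
  imports Defs
begin

text \<open>The discount function is a combination of \<open>exp (- (\<delta> + \<pi>) t)\<close> and \<open>exp (- \<rho> t)\<close>, so everything
  reduces to the two integrals \<open>J a k\<close> of \<open>exp (- a t) ln \<sigma>\<close> along the trajectory through \<open>k\<close>,
  \<open>a \<in> {\<delta> + \<pi>, \<rho>}\<close>. Since the flow is differentiable in \<open>k\<close> with the linearised solution as its
  derivative, \<open>P1 c = ln c - ln (\<sigma> k) + (\<sigma> k - c) v' k\<close>, and \<open>\<sigma>\<close> is an equilibrium iff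
  \<open>v' = 1 / \<sigma>\<close>. Along trajectories \<open>J a\<close> is the only convergent solution of
  \<open>A' = a A - ln \<sigma>\<close>, and a linear change of variables turns these two scalar equations into the
  system for \<open>(v, w)\<close>. For the converse, uniqueness identifies \<open>v\<close> with the integral defining the
  value of the strategy.\<close>

section \<open>One-sided calculus on the half-line\<close>

lemma at_within_atLeast_interior: "t > (0::real) \<Longrightarrow> at t within {0..} = at t"
  by (rule at_within_interior) simp

lemma has_real_derivative_zero_imp_constant:
  fixes F :: "real \<Rightarrow> real"
  assumes "\<And>t. t \<ge> 0 \<Longrightarrow> (F has_real_derivative 0) (at t within {0..})" and "t \<ge> 0"
  shows "F t = F 0"
proof -
  have "\<exists>c. \<forall>x\<in>{0..}. F x = c"
    by (rule has_field_derivative_zero_constant) (use assms in auto)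
  then show ?thesis using assms(2) by auto
qed

text \<open>For \<open>s \<ge> 0\<close> the shift maps \<open>{0..}\<close> into itself, so after
  restricting the derivative of \<open>F\<close> to the image of the shift the chain rule
  applies.\<close>

lemma has_real_derivative_shift_atLeast:
  fixes F :: "real \<Rightarrow> real"
  assumes "(F has_real_derivative d) (at (t + s) within {0..})" and "s \<ge> 0"
  shows "((\<lambda>t. F (t + s)) has_real_derivative d) (at t within {0..})"
proof -
  have "(F has_real_derivative d) (at (t + s) within ((\<lambda>t. t + s) ` {0..}))"
    by (rule DERIV_subset[OF assms(1)]) (use \<open>s \<ge> 0\<close> in auto)
  moreover have "((\<lambda>t. t + s) has_real_derivative 1) (at t within {0..})"
    by (auto intro!: derivative_eq_intros)
  ultimately show ?thesis
    using DERIV_image_chain by (fastforce simp: o_def)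
qed

lemma integral_has_real_derivative_atLeast:
  fixes \<phi> :: "real \<Rightarrow> real"
  assumes "continuous_on {0..} \<phi>" and "t \<ge> 0"
  shows "((\<lambda>t. integral {0..t} \<phi>) has_real_derivative \<phi> t) (at t within {0..})"
proof -
  \<comment> \<open>Integrating up to \<open>t + 1\<close> leaves room to the right of
    \<open>t\<close>, so that \<open>{0..t+1}\<close> and \<open>{0..}\<close> agree near
    \<open>t\<close>.\<close>
  have "((\<lambda>t. integral {0..t} \<phi>) has_real_derivative \<phi> t) (at t within {0..t+1})"
    by (rule integral_has_real_derivative) (use assms in \<open>auto intro: continuous_on_subset\<close>)
  moreover have "at t within {0..t+1} = at t within {0..}"
    by (rule at_within_nhd[of _ "{..<t+1}"]) auto
  ultimately show ?thesis by simp
qed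

lemma has_integral_from_antiderivative:
  fixes F :: "real \<Rightarrow> real"
  assumes "\<And>t. t \<ge> 0 \<Longrightarrow> (F has_real_derivative \<phi> t) (at t within {0..})" and "T \<ge> 0"
  shows "(\<phi> has_integral (F T - F 0)) {0..T}"
proof (rule fundamental_theorem_of_calculus)
  show "(F has_vector_derivative \<phi> t) (at t within {0..T})" if "t \<in> {0..T}" for t
    using DERIV_subset[OF assms(1)[of t]] that
    by (auto simp: has_real_derivative_iff_has_vector_derivative)
qed (use assms in auto)

section \<open>Discounted integrals\<close>

text \<open>The dominating function is \<open>B * exp (- a * t)\<close>. Absolute integrability is
  recorded because it passes to subintervals and makes the truncated integrals converge to the full
  one.\<close>

lemma discounted_integrable:
  fixes L :: "real \<Rightarrow> real"
  assumes "a > 0" and L: "continuous_on {0..} L" and B: "\<And>t. t \<ge> 0 \<Longrightarrow> \<bar>L t\<bar> \<le> B"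
  shows "(\<lambda>t. exp (- a * t) * L t) absolutely_integrable_on {0..}"
proof (rule measurable_bounded_by_integrable_imp_absolutely_integrable)
  show "(\<lambda>t. exp (- a * t) * L t) \<in> borel_measurable (lebesgue_on {0..})"
    by (intro continuous_imp_measurable_on_sets_lebesgue continuous_intros L) auto
  show "(\<lambda>t. B * exp (- a * t)) integrable_on {0..}"
    using integrable_on_exp_minus_to_infinity[OF \<open>a > 0\<close>] by (rule integrable_on_mult_right)
  show "norm (exp (- a * t) * L t) \<le> B * exp (- a * t)" if "t \<in> {0..}" for t
    using B[of t] that by (auto simp: abs_mult mult.commute)
qed auto

lemma discounted_integral_tendsto:
  fixes L :: "real \<Rightarrow> real"
  assumes "a > 0" and L: "continuous_on {0..} L" and B: "\<And>t. t \<ge> 0 \<Longrightarrow> \<bar>L t\<bar> \<le> B"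
  shows "((\<lambda>T. integral {0..T} (\<lambda>t. exp (- a * t) * L t)) \<longlongrightarrow>
           integral {0..} (\<lambda>t. exp (- a * t) * L t)) at_top"
proof -
  let ?\<phi> = "\<lambda>t. exp (- a * t) * L t"
  note abs = discounted_integrable[OF assms]
  have "((\<lambda>b. set_lebesgue_integral lebesgue {0..b} ?\<phi>) \<longlongrightarrow>
      set_lebesgue_integral lebesgue {0..} ?\<phi>) at_top"
    by (rule tendsto_set_lebesgue_integral_at_top) (use abs in auto)
  moreover have "set_lebesgue_integral lebesgue {0..b} ?\<phi> = integral {0..b} ?\<phi>" for b
    by (rule set_lebesgue_integral_eq_integral)
       (rule set_integrable_subset[OF abs], auto)
  ultimately show ?thesis
    using set_lebesgue_integral_eq_integral(2)[OF abs] by simp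
qed

text \<open>With the integrating factor, \<open>- exp (- a * t) * A t\<close> is an antiderivative
  of the integrand. As \<open>A\<close> converges, the boundary term at infinity vanishes and only
  \<open>A 0\<close> remains. Convergence thus excludes adding a multiple of
  \<open>exp (a * t)\<close>, which solves the homogeneous equation.\<close>

lemma discounted_integral_eq_if_convergent_solution:
  fixes L A :: "real \<Rightarrow> real"
  assumes "a > 0" and L: "continuous_on {0..} L" and B: "\<And>t. t \<ge> 0 \<Longrightarrow> \<bar>L t\<bar> \<le> B"
    and A: "\<And>t. t \<ge> 0 \<Longrightarrow> (A has_real_derivative (a * A t - L t)) (at t within {0..})"
    and lim: "(A \<longlongrightarrow> l) at_top"
  shows "integral {0..} (\<lambda>t. exp (- a * t) * L t) = A 0"
proof (rule tendsto_unique)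
  show "((\<lambda>T. integral {0..T} (\<lambda>t. exp (- a * t) * L t)) \<longlongrightarrow>
           integral {0..} (\<lambda>t. exp (- a * t) * L t)) at_top"
    by (rule discounted_integral_tendsto) fact+
  have "((\<lambda>t. - exp (- a * t) * A t) has_real_derivative exp (- a * t) * L t) (at t within {0..})"
    if "t \<ge> 0" for t
    using that by (auto intro!: derivative_eq_intros A simp: algebra_simps)
  from has_integral_from_antiderivative[OF this]
  have "integral {0..T} (\<lambda>t. exp (- a * t) * L t) = A 0 - exp (- a * T) * A T" if "T \<ge> 0" for T
    using that by (auto dest!: integral_unique)
  then have "\<forall>\<^sub>F T in at_top. A 0 - exp (- a * T) * A T = integral {0..T} (\<lambda>t. exp (- a * t) * L t)"
    by (metis (mono_tags, lifting) eventually_at_top_linorder)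
  moreover have "((\<lambda>T. exp (- a * T)) \<longlongrightarrow> 0) at_top"
    using \<open>a > 0\<close>
    by (intro filterlim_compose[OF exp_at_bot] filterlim_tendsto_neg_mult_at_bot[OF tendsto_const])
       (auto simp: filterlim_ident)
  then have "((\<lambda>T. A 0 - exp (- a * T) * A T) \<longlongrightarrow> A 0 - 0 * l) at_top"
    by (intro tendsto_intros lim)
  ultimately show "((\<lambda>T. integral {0..T} (\<lambda>t. exp (- a * t) * L t)) \<longlongrightarrow> A 0) at_top"
    by (simp add: filterlim_cong[OF refl refl])
qed auto

text \<open>This is the substitution of \<open>t + s\<close> for \<open>t\<close>, carried out on
  \<open>{0..T}\<close> through an antiderivative before \<open>T\<close> tends to infinity.\<close>

lemma discounted_integral_shift:
  fixes L :: "real \<Rightarrow> real"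
  assumes "a > 0" and L: "continuous_on {0..} L" and B: "\<And>t. t \<ge> 0 \<Longrightarrow> \<bar>L t\<bar> \<le> B" and "s \<ge> 0"
  shows "integral {0..} (\<lambda>t. exp (- a * t) * L (t + s)) =
    exp (a * s) * (integral {0..} (\<lambda>t. exp (- a * t) * L t) - integral {0..s} (\<lambda>t. exp (- a * t) * L t))"
    (is "_ = exp (a * s) * (?I - ?J s)")
proof (rule tendsto_unique)
  let ?Ls = "\<lambda>t. L (t + s)"
  have shift: "continuous_on {0..} ?Ls"
    by (rule continuous_on_compose2[OF L]) (use \<open>s \<ge> 0\<close> in \<open>auto intro!: continuous_intros\<close>)
  show "((\<lambda>T. integral {0..T} (\<lambda>t. exp (- a * t) * ?Ls t)) \<longlongrightarrow>
           integral {0..} (\<lambda>t. exp (- a * t) * ?Ls t)) at_top"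
    by (rule discounted_integral_tendsto[OF \<open>a > 0\<close> shift, of B]) (use B \<open>s \<ge> 0\<close> in auto)
  have "((\<lambda>T. exp (a * s) * ?J (T + s)) has_real_derivative exp (- a * T) * ?Ls T) (at T within {0..})"
    if "T \<ge> 0" for T
  proof -
    have J: "(?J has_real_derivative exp (- a * (T + s)) * L (T + s)) (at (T + s) within {0..})"
      by (rule integral_has_real_derivative_atLeast)
        (use that \<open>s \<ge> 0\<close> in \<open>auto intro!: continuous_intros L\<close>)
    have "((\<lambda>T. ?J (T + s)) has_real_derivative exp (- a * (T + s)) * L (T + s) * 1)
        (at T within {0..})"
      using has_real_derivative_shift_atLeast[OF J \<open>s \<ge> 0\<close>] by simp
    from DERIV_cmult[OF this, of "exp (a * s)"] show ?thesis
      by (simp add: mult.assoc[symmetric] exp_add[symmetric] algebra_simps)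
  qed
  note FTC = has_integral_from_antiderivative[OF this]
  have "\<forall>\<^sub>F T in at_top. exp (a * s) * (?J (T + s) - ?J s) =
      integral {0..T} (\<lambda>t. exp (- a * t) * ?Ls t)"
    using eventually_ge_at_top[of 0]
    by eventually_elim (simp only: integral_unique[OF FTC] right_diff_distrib add_0)
  moreover have "filterlim (\<lambda>T::real. T + s) at_top at_top"
    by (rule filterlim_at_top_mono[OF filterlim_ident]) (use \<open>s \<ge> 0\<close> in auto)
  from filterlim_compose[OF discounted_integral_tendsto[OF assms(1-3)] this]
  have "((\<lambda>T. exp (a * s) * (?J (T + s) - ?J s)) \<longlongrightarrow> exp (a * s) * (?I - ?J s)) at_top"
    by (intro tendsto_intros)
  ultimately show "((\<lambda>T. integral {0..T} (\<lambda>t. exp (- a * t) * ?Ls t)) \<longlongrightarrow>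
      exp (a * s) * (?I - ?J s)) at_top"
    by (simp add: filterlim_cong[OF refl refl])
qed auto

text \<open>In the closed form of the shifted integral, \<open>s\<close> enters only through an
  exponential and the upper limit of an integral, so the product rule suffices and \<open>L\<close>
  need not be differentiated.\<close>

lemma discounted_integral_shift_derivative:
  fixes L :: "real \<Rightarrow> real"
  assumes "a > 0" and L: "continuous_on {0..} L" and B: "\<And>t. t \<ge> 0 \<Longrightarrow> \<bar>L t\<bar> \<le> B"
  shows "((\<lambda>s. integral {0..} (\<lambda>t. exp (- a * t) * L (t + s))) has_real_derivative
      (a * integral {0..} (\<lambda>t. exp (- a * t) * L t) - L 0)) (at 0 within {0..})"
proof (rule has_field_derivative_transform_within)
  let ?J = "\<lambda>s. integral {0..s} (\<lambda>t. exp (- a * t) * L t)"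
  let ?I = "integral {0..} (\<lambda>t. exp (- a * t) * L t)"
  have "(?J has_real_derivative exp (- a * 0) * L 0) (at 0 within {0..})"
    by (rule integral_has_real_derivative_atLeast) (auto intro!: continuous_intros L)
  then show "((\<lambda>s. exp (a * s) * (?I - ?J s)) has_real_derivative a * ?I - L 0) (at 0 within {0..})"
    by (auto intro!: derivative_eq_intros)
  show "exp (a * s) * (?I - ?J s) = integral {0..} (\<lambda>t. exp (- a * t) * L (t + s))"
    if "s \<in> {0..}" for s
    using discounted_integral_shift[OF assms, of s] that by simp
qed (auto intro: zero_less_one)

section \<open>Scalar autonomous differential equations\<close>

text \<open>Gronwall's inequality for the squared distance, which unlike the distance itself is
  differentiable where the solutions meet.\<close>

lemma solutions_dist_le:
  fixes x y g g' :: "real \<Rightarrow> real"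
  assumes "T \<ge> 0"
    and x: "\<And>t. t \<in> {0..T} \<Longrightarrow> (x has_real_derivative g (x t)) (at t within {0..})"
    and y: "\<And>t. t \<in> {0..T} \<Longrightarrow> (y has_real_derivative g (y t)) (at t within {0..})"
    and x_in: "\<And>t. t \<in> {0..T} \<Longrightarrow> x t \<in> {a..b}"
    and y_in: "\<And>t. t \<in> {0..T} \<Longrightarrow> y t \<in> {a..b}"
    and g: "\<And>z. z \<in> {a..b} \<Longrightarrow> (g has_real_derivative g' z) (at z)"
    and M: "\<And>z. z \<in> {a..b} \<Longrightarrow> \<bar>g' z\<bar> \<le> M"
  shows "\<bar>x T - y T\<bar> \<le> exp (M * T) * \<bar>x 0 - y 0\<bar>"
proof -
  \<comment> \<open>On \<open>{a..b}\<close> the function \<open>g\<close> is Lipschitz with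
    constant \<open>M\<close>, so the squared distance grows at most at rate \<open>2 * M\<close>;
    this weight makes the product nonincreasing.\<close>
  define \<phi> where "\<phi> t = (x t - y t)\<^sup>2 * exp (- 2 * M * t)" for t
  have \<phi>: "(\<phi> has_real_derivative
      (2 * (x t - y t) * (g (x t) - g (y t)) - 2 * M * (x t - y t)\<^sup>2) * exp (- 2 * M * t))
      (at t within {0..})" if "t \<in> {0..T}" for t
    unfolding \<phi>_def
    by (rule derivative_eq_intros x y that refl | simp add: algebra_simps)+
  have "\<phi> T \<le> \<phi> 0"
  proof (rule DERIV_nonpos_imp_decreasing_open[of 0 T \<phi>])
    show "continuous_on {0..T} \<phi>"
      by (rule DERIV_continuous_on[OF DERIV_subset[OF \<phi>]]) auto
    fix t assume t: "0 < t" "t < T"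
    have "\<bar>g (x t) - g (y t)\<bar> \<le> M * \<bar>x t - y t\<bar>"
      using field_differentiable_bound[of "{a..b}" g g' M "x t" "y t"] x_in[of t] y_in[of t] t M g
      by (auto intro: has_field_derivative_at_within)
    then have "\<bar>x t - y t\<bar> * \<bar>g (x t) - g (y t)\<bar> \<le> \<bar>x t - y t\<bar> * (M * \<bar>x t - y t\<bar>)"
      by (rule mult_left_mono) simp
    moreover have "(x t - y t) * (g (x t) - g (y t)) \<le> \<bar>x t - y t\<bar> * \<bar>g (x t) - g (y t)\<bar>"
      by (metis abs_ge_self abs_mult)
    moreover have "\<bar>x t - y t\<bar> * (M * \<bar>x t - y t\<bar>) = M * (x t - y t)\<^sup>2"
      by (simp add: power2_eq_square abs_mult[symmetric] mult.left_commute)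
    ultimately have "2 * (x t - y t) * (g (x t) - g (y t)) - 2 * M * (x t - y t)\<^sup>2 \<le> 0"
      by linarith
    then show "\<exists>d. (\<phi> has_real_derivative d) (at t) \<and> d \<le> 0"
      using \<phi>[of t] t
      by (intro exI conjI) (auto simp: at_within_atLeast_interior intro: mult_nonpos_nonneg)
  qed (use assms in simp)
  then have "(x T - y T)\<^sup>2 * exp (- 2 * M * T) * exp (2 * M * T) \<le> (x 0 - y 0)\<^sup>2 * exp (2 * M * T)"
    by (intro mult_right_mono) (auto simp: \<phi>_def)
  then have "(x T - y T)\<^sup>2 \<le> (x 0 - y 0)\<^sup>2 * exp (2 * M * T)"
    by (simp add: mult.assoc exp_add[symmetric])
  also have "\<dots> = (exp (M * T) * \<bar>x 0 - y 0\<bar>)\<^sup>2"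
    by (simp add: power_mult_distrib exp_double mult.assoc)
  finally show ?thesis
    by (intro power2_le_imp_le[of "\<bar>x T - y T\<bar>"]) simp_all
qed

lemma is_interval_Icc_subset:
  fixes K :: "real set"
  assumes "is_interval K" "a \<in> K" "b \<in> K"
  shows "{a..b} \<subseteq> K"
  using assms unfolding is_interval_1 by (meson atLeastAtMost_iff subsetI)

text \<open>A bound on a derivative gives a Lipschitz bound on an interval, so a compact set of
  visited states is enlarged to an interval, which stays inside \<open>K\<close>.\<close>

lemma compact_interval_hull:
  fixes S K :: "real set"
  assumes "compact S" "S \<noteq> {}" "S \<subseteq> K" "is_interval K"
  obtains a b where "S \<subseteq> {a..b}" "{a..b} \<subseteq> K"
proof -
  obtain a where a: "a \<in> S" "\<forall>z\<in>S. a \<le> z"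
    using compact_attains_inf[OF assms(1,2)] by blast
  obtain b where b: "b \<in> S" "\<forall>z\<in>S. z \<le> b"
    using compact_attains_sup[OF assms(1,2)] by blast
  show ?thesis
  proof
    show "S \<subseteq> {a..b}" using a b by auto
    show "{a..b} \<subseteq> K" using a b assms(3,4) by (intro is_interval_Icc_subset) auto
  qed
qed

text \<open>Up to time \<open>T\<close> both solutions stay in a compact subinterval of
  \<open>K\<close>, on which \<open>g'\<close> is bounded. The distance estimate then applies with
  initial distance zero.\<close>

lemma solution_unique:
  fixes x y g g' :: "real \<Rightarrow> real"
  assumes "is_interval K"
    and g: "\<And>z. z \<in> K \<Longrightarrow> (g has_real_derivative g' z) (at z)" and g': "continuous_on K g'"
    and x: "\<And>t. t \<ge> 0 \<Longrightarrow> (x has_real_derivative g (x t)) (at t within {0..})"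
    and y: "\<And>t. t \<ge> 0 \<Longrightarrow> (y has_real_derivative g (y t)) (at t within {0..})"
    and x_in: "\<And>t. t \<ge> 0 \<Longrightarrow> x t \<in> K" and y_in: "\<And>t. t \<ge> 0 \<Longrightarrow> y t \<in> K"
    and "x 0 = y 0" and "T \<ge> 0"
  shows "x T = y T"
proof -
  have "continuous_on {0..T} x" "continuous_on {0..T} y"
    by (rule DERIV_continuous_on[OF DERIV_subset[OF x]], auto)
      (rule DERIV_continuous_on[OF DERIV_subset[OF y]], auto)
  then have "compact (x ` {0..T} \<union> y ` {0..T})"
    by (intro compact_Un compact_continuous_image) auto
  moreover have "x ` {0..T} \<union> y ` {0..T} \<subseteq> K" "x ` {0..T} \<union> y ` {0..T} \<noteq> {}"
    using x_in y_in \<open>T \<ge> 0\<close> by auto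
  ultimately obtain a b where ab: "x ` {0..T} \<union> y ` {0..T} \<subseteq> {a..b}" "{a..b} \<subseteq> K"
    using compact_interval_hull \<open>is_interval K\<close> by metis
  have "compact (g' ` {a..b})"
    by (intro compact_continuous_image continuous_on_subset[OF g' ab(2)]) auto
  then obtain M where M: "\<And>z. z \<in> {a..b} \<Longrightarrow> \<bar>g' z\<bar> \<le> M"
    by (metis bounded_iff compact_imp_bounded imageI real_norm_def)
  have "\<bar>x T - y T\<bar> \<le> exp (M * T) * \<bar>x 0 - y 0\<bar>"
    by (rule solutions_dist_le[where a = a and b = b and g = g and g' = g'])
      (use x y ab M g \<open>T \<ge> 0\<close> in \<open>auto simp: image_subset_iff\<close>)
  then show ?thesis using \<open>x 0 = y 0\<close> by simp
qed


section \<open>The flow and its dependence on the initial value\<close>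

locale convergent_flow =
  fixes K :: "real set" and g g' :: "real \<Rightarrow> real" and X :: "real \<Rightarrow> real \<Rightarrow> real" and kbar :: real
  assumes open_K: "open K" and interval_K: "is_interval K" and kbar_in: "kbar \<in> K"
    and g_deriv: "z \<in> K \<Longrightarrow> (g has_real_derivative g' z) (at z)"
    and g'_cont: "continuous_on K g'"
    and X_0: "k \<in> K \<Longrightarrow> X 0 k = k"
    and X_in: "k \<in> K \<Longrightarrow> t \<ge> 0 \<Longrightarrow> X t k \<in> K"
    and X_deriv: "k \<in> K \<Longrightarrow> t \<ge> 0 \<Longrightarrow>
      ((\<lambda>t. X t k) has_real_derivative g (X t k)) (at t within {0..})"
    and X_lim: "k \<in> K \<Longrightarrow> ((\<lambda>t. X t k) \<longlongrightarrow> kbar) at_top"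
begin

lemma X_cont: "k \<in> K \<Longrightarrow> continuous_on {0..} (\<lambda>t. X t k)"
  by (rule DERIV_continuous_on[OF X_deriv]) auto

lemma X_unique:
  assumes "\<And>t. t \<ge> 0 \<Longrightarrow> (y has_real_derivative g (y t)) (at t within {0..})"
    and "\<And>t. t \<ge> 0 \<Longrightarrow> y t \<in> K" and "t \<ge> 0"
  shows "X t (y 0) = y t"
  by (rule solution_unique[OF interval_K g_deriv g'_cont, of "\<lambda>t. X t (y 0)" y])
    (use assms X_0 X_in X_deriv in auto)

text \<open>The shifted trajectory solves the same autonomous equation, so uniqueness identifies it
  with the one started at \<open>X s k\<close>.\<close>

lemma X_add:
  assumes "k \<in> K" "s \<ge> 0" "t \<ge> 0"
  shows "X t (X s k) = X (t + s) k"
proof -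
  have "((\<lambda>t. X (t + s) k) has_real_derivative g (X (t + s) k)) (at t within {0..})" if "t \<ge> 0" for t
    by (rule has_real_derivative_shift_atLeast[OF X_deriv]) (use assms that in auto)
  from X_unique[OF this, of t] show ?thesis using assms X_in by simp
qed

text \<open>An excursion of a trajectory beyond both \<open>k\<close> and \<open>kbar\<close> would have an interior extremum, i.e.
  an equilibrium different from \<open>kbar\<close>, from which the trajectory could not converge to \<open>kbar\<close>.\<close>

lemma signed_X_le:
  assumes "k \<in> K" "t \<ge> 0" and s: "s = 1 \<or> s = -1"
  shows "s * X t k \<le> max (s * k) (s * kbar)"
proof (rule ccontr)
  assume "\<not> ?thesis"
  then have gt: "s * k < s * X t k" "s * kbar < s * X t k" by auto
  have "((\<lambda>t. s * X t k) \<longlongrightarrow> s * kbar) at_top"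
    by (intro tendsto_intros X_lim assms)
  then have "\<forall>\<^sub>F \<tau> in at_top. s * X \<tau> k < s * X t k"
    using gt(2) by (rule order_tendstoD)
  then obtain T where T: "\<And>\<tau>. \<tau> \<ge> T \<Longrightarrow> s * X \<tau> k < s * X t k"
    by (auto simp: eventually_at_top_linorder)
  \<comment> \<open>After \<open>T\<close> the trajectory lies below its level at time
    \<open>t\<close>, so a maximum over \<open>{0..max T t}\<close> is one over all nonnegative
    times, and \<open>u\<close> becomes an interior critical time.\<close>
  have "continuous_on {0..max T t} (\<lambda>\<tau>. s * X \<tau> k)"
    by (intro continuous_intros continuous_on_subset[OF X_cont[OF \<open>k \<in> K\<close>]]) auto
  then have "\<exists>u\<in>{0..max T t}. \<forall>\<tau>\<in>{0..max T t}. s * X \<tau> k \<le> s * X u k"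
    using \<open>t \<ge> 0\<close> by (intro continuous_attains_sup) auto
  then obtain u where u: "u \<in> {0..max T t}"
    and max: "\<And>\<tau>. \<tau> \<in> {0..max T t} \<Longrightarrow> s * X \<tau> k \<le> s * X u k"
    by blast
  have u_ge: "s * X t k \<le> s * X u k" using max[of t] \<open>t \<ge> 0\<close> by auto
  have "u \<noteq> 0" using u_ge gt X_0[OF \<open>k \<in> K\<close>] by auto
  then have "u > 0" using u by auto
  have "((\<lambda>\<tau>. s * X \<tau> k) has_real_derivative s * g (X u k)) (at u)"
    using X_deriv[OF \<open>k \<in> K\<close>, of u] \<open>u > 0\<close>
    by (auto intro: DERIV_cmult simp: at_within_atLeast_interior)
  moreover have "\<forall>y. \<bar>u - y\<bar> < u \<longrightarrow> s * X y k \<le> s * X u k"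
  proof (intro allI impI)
    fix y assume "\<bar>u - y\<bar> < u"
    then show "s * X y k \<le> s * X u k"
      using max[of y] T[of y] u_ge by (cases "T \<le> y") (auto simp: le_max_iff_disj)
  qed
  ultimately have "s * g (X u k) = 0"
    using \<open>u > 0\<close> by (intro DERIV_local_max)
  then have "g (X u k) = 0" using s by auto
  have X_u_in: "X u k \<in> K" using X_in \<open>k \<in> K\<close> \<open>u > 0\<close> by simp
  then have "X \<tau> (X u k) = X u k" if "\<tau> \<ge> 0" for \<tau>
    using X_unique[of "\<lambda>_. X u k" \<tau>] \<open>g (X u k) = 0\<close> that by auto
  then have "((\<lambda>\<tau>. X \<tau> (X u k)) \<longlongrightarrow> X u k) at_top"
    by (intro tendsto_eventually) (auto simp: eventually_at_top_linorder)
  then have "X u k = kbar"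
    using X_lim[OF X_u_in] by (rule tendsto_unique[rotated]) simp
  then show False using u_ge gt by simp
qed

text \<open>The two signs bound the trajectory from above and from below. The interval depends
  neither on the time nor on which of its points is the initial value, which gives uniform
  estimates.\<close>

lemma X_between:
  assumes "k \<in> {a..b}" "kbar \<in> {a..b}" "k \<in> K" "t \<ge> 0"
  shows "X t k \<in> {a..b}"
  using signed_X_le[of k t 1] signed_X_le[of k t "-1"] assms by auto

lemma X_kbar: "t \<ge> 0 \<Longrightarrow> X t kbar = kbar"
  using X_between[of kbar kbar kbar t] kbar_in by simp

lemma g_kbar: "g kbar = 0"
proof -
  \<comment> \<open>Time \<open>1\<close> stands for any positive time, where a two-sided derivative
    is available and unique.\<close>
  have "((\<lambda>t. X t kbar) has_real_derivative g kbar) (at 1)"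
    using X_deriv[OF kbar_in, of 1] X_kbar[of 1] by (simp add: at_within_atLeast_interior)
  moreover have "((\<lambda>t. X t kbar) has_real_derivative 0) (at 1)"
    by (rule has_field_derivative_transform_within[of "\<lambda>_. kbar" _ _ UNIV 1])
      (auto simp: X_kbar dist_real_def)
  ultimately show ?thesis by (rule DERIV_unique)
qed

text \<open>The fundamental solution of the equation linearised along the trajectory through
  \<open>k\<close>. In dimension one it is an explicit exponential, so it is positive and may be
  divided by.\<close>

definition Y :: "real \<Rightarrow> real \<Rightarrow> real" where
  "Y t k = exp (integral {0..t} (\<lambda>s. g' (X s k)))"

lemma Y_pos: "Y t k > 0" and Y_0: "Y 0 k = 1"
  by (simp_all add: Y_def)

lemma Y_deriv:
  assumes "k \<in> K" "t \<ge> 0"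
  shows "((\<lambda>t. Y t k) has_real_derivative g' (X t k) * Y t k) (at t within {0..})"
proof -
  have "continuous_on {0..} (\<lambda>s. g' (X s k))"
    by (rule continuous_on_compose2[OF g'_cont X_cont]) (use assms X_in in auto)
  from integral_has_real_derivative_atLeast[OF this \<open>t \<ge> 0\<close>] show ?thesis
    unfolding Y_def by (auto intro!: derivative_eq_intros)
qed

text \<open>By the quotient rule \<open>y t / Y t k\<close> has derivative zero, and
  \<open>Y\<close> starts at 1.\<close>

lemma linearised_unique:
  assumes "k \<in> K" "t \<ge> 0"
    and "\<And>t. t \<ge> 0 \<Longrightarrow> (y has_real_derivative g' (X t k) * y t) (at t within {0..})"
  shows "y t = y 0 * Y t k"
proof -
  have "((\<lambda>t. y t / Y t k) has_real_derivative 0) (at t within {0..})" if "t \<ge> 0" for t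
    using Y_pos[of t k]
    by (auto intro!: derivative_eq_intros assms(3) Y_deriv \<open>k \<in> K\<close> that simp: field_simps)
  from has_real_derivative_zero_imp_constant[OF this \<open>t \<ge> 0\<close>] show ?thesis
    using Y_pos[of t k] by (simp add: Y_0 field_simps)
qed

text \<open>The difference of two trajectories, divided by \<open>Y\<close>, has a derivative that is small compared
  with the distance of the initial values.\<close>

lemma X_deriv_initial:
  assumes "k \<in> K" "T \<ge> 0"
  shows "((\<lambda>\<kappa>. X T \<kappa>) has_real_derivative Y T k) (at k)"
  unfolding has_field_derivative_def has_derivative_at_alt
proof (intro conjI allI impI bounded_linear_mult_right)
  fix e :: real assume "e > 0"
  obtain r where "r > 0" and r: "cball k r \<subseteq> K"
    using open_K \<open>k \<in> K\<close> open_contains_cball by blast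
  \<comment> \<open>This interval contains the ball of radius \<open>r\<close> about
    \<open>k\<close> as well as \<open>kbar\<close>, so it traps every trajectory that starts in the
    ball.\<close>
  define a b where "a = min (k - r) kbar" and "b = max (k + r) kbar"
  have "k - r \<in> K" "k + r \<in> K" using r \<open>r > 0\<close> by (auto simp: subset_iff dist_real_def)
  then have "a \<in> K" "b \<in> K" using kbar_in by (auto simp: a_def b_def min_def max_def)
  then have ab: "{a..b} \<subseteq> K" by (rule is_interval_Icc_subset[OF interval_K])
  have cont: "continuous_on {a..b} g'" by (rule continuous_on_subset[OF g'_cont ab])
  then have "bounded (g' ` {a..b})"
    by (intro compact_imp_bounded compact_continuous_image) auto
  then obtain M where M: "\<And>z. z \<in> {a..b} \<Longrightarrow> \<bar>g' z\<bar> \<le> M"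
    by (metis bounded_iff imageI real_norm_def)
  have "a \<le> b" using \<open>r > 0\<close> by (auto simp: a_def b_def)
  then have "M \<ge> 0" using M[of a] by auto
  have "continuous_on {0..} (\<lambda>t. Y t k)"
    by (rule DERIV_continuous_on[OF Y_deriv]) (use \<open>k \<in> K\<close> in auto)
  then have "continuous_on {0..T} (\<lambda>t. inverse (Y t k))"
    using Y_pos by (intro continuous_intros) (auto intro: continuous_on_subset simp: less_imp_neq[symmetric])
  then have "bounded ((\<lambda>t. inverse (Y t k)) ` {0..T})"
    by (intro compact_imp_bounded compact_continuous_image) auto
  then obtain C where C: "\<And>t. t \<in> {0..T} \<Longrightarrow> \<bar>inverse (Y t k)\<bar> \<le> C"
    by (metis bounded_iff imageI real_norm_def)
  then have "C \<ge> 0" using C[of 0] \<open>T \<ge> 0\<close> by (simp add: Y_0)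
  \<comment> \<open>\<open>Q\<close> collects the constants of the final estimate, and
    \<open>\<eta>\<close> below is the tolerated variation of \<open>g'\<close>. Adding 1 to
    \<open>Q\<close> keeps the quotient meaningful when \<open>T = 0\<close>.\<close>
  define Q where "Q = Y T k * (C * exp (M * T) * T)"
  have "Q \<ge> 0" using Y_pos[of T k] \<open>C \<ge> 0\<close> \<open>T \<ge> 0\<close> by (simp add: Q_def)
  define \<eta> where "\<eta> = e / (Q + 1)"
  have "\<eta> > 0" using \<open>e > 0\<close> \<open>Q \<ge> 0\<close> by (simp add: \<eta>_def)
  have Q\<eta>: "Q * \<eta> \<le> e" using \<open>e > 0\<close> \<open>Q \<ge> 0\<close> by (simp add: \<eta>_def field_simps)
  have "uniformly_continuous_on {a..b} g'"
    using cont by (rule compact_uniformly_continuous) auto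
  then obtain d0 where "d0 > 0" and d0: "\<And>u v. u \<in> {a..b} \<Longrightarrow> v \<in> {a..b} \<Longrightarrow>
      \<bar>u - v\<bar> < d0 \<Longrightarrow> \<bar>g' u - g' v\<bar> < \<eta>"
    unfolding uniformly_continuous_on_def dist_real_def using \<open>\<eta> > 0\<close> by metis
  show "\<exists>d>0. \<forall>\<kappa>. norm (\<kappa> - k) < d \<longrightarrow>
      norm (X T \<kappa> - X T k - Y T k * (\<kappa> - k)) \<le> e * norm (\<kappa> - k)"
  \<comment> \<open>The first bound keeps \<open>\<kappa>\<close> in the ball; the second, through
    the distance estimate, keeps the two trajectories closer than \<open>d0\<close> up to time
    \<open>T\<close>.\<close>
  proof (intro exI[of _ "min r (d0 * exp (- M * T))"] conjI allI impI)
    show "0 < min r (d0 * exp (- M * T))" using \<open>r > 0\<close> \<open>d0 > 0\<close> by simp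
    fix \<kappa> assume "norm (\<kappa> - k) < min r (d0 * exp (- M * T))"
    then have \<kappa>: "\<bar>\<kappa> - k\<bar> < r" "\<bar>\<kappa> - k\<bar> < d0 * exp (- M * T)" by auto
    have k_ab: "k \<in> {a..b}" and \<kappa>_ab: "\<kappa> \<in> {a..b}" and kbar_ab: "kbar \<in> {a..b}"
      using \<kappa>(1) \<open>r > 0\<close> by (auto simp: a_def b_def)
    then have "\<kappa> \<in> K" using ab by auto
    have X_ab: "X t k \<in> {a..b}" "X t \<kappa> \<in> {a..b}" if "t \<ge> 0" for t
      using X_between k_ab \<kappa>_ab kbar_ab \<open>k \<in> K\<close> \<open>\<kappa> \<in> K\<close> that by blast+
    define D where "D t = X t \<kappa> - X t k" for t
    have D_le: "\<bar>D t\<bar> \<le> exp (M * T) * \<bar>\<kappa> - k\<bar>" if "t \<in> {0..T}" for t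
    proof -
      have "\<bar>D t\<bar> \<le> exp (M * t) * \<bar>X 0 \<kappa> - X 0 k\<bar>"
        unfolding D_def
        by (rule solutions_dist_le[where a = a and b = b and g = g and g' = g'])
          (use that X_deriv X_ab M ab g_deriv \<open>k \<in> K\<close> \<open>\<kappa> \<in> K\<close> in auto)
      also have "\<dots> \<le> exp (M * T) * \<bar>\<kappa> - k\<bar>"
        using that \<open>M \<ge> 0\<close> X_0 \<open>k \<in> K\<close> \<open>\<kappa> \<in> K\<close> by (auto intro!: mult_right_mono mult_left_mono)
      finally show ?thesis .
    qed
    have D_small: "\<bar>D t\<bar> < d0" if "t \<in> {0..T}" for t
    proof -
      have "\<bar>D t\<bar> < exp (M * T) * (d0 * exp (- M * T))"
        using D_le[OF that] \<kappa>(2) by (meson exp_gt_zero le_less_trans mult_strict_left_mono)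
      then show ?thesis by (simp add: exp_minus field_simps)
    qed
    \<comment> \<open>The error of linearising \<open>g\<close> at \<open>X t k\<close>. To bound
      it, the linear function of slope \<open>g' (X t k)\<close> is subtracted first, so that the
      mean value inequality meets only the variation of \<open>g'\<close>.\<close>
    define R where "R t = g (X t \<kappa>) - g (X t k) - g' (X t k) * D t" for t
    have R: "\<bar>R t\<bar> \<le> \<eta> * \<bar>D t\<bar>" if t: "t \<in> {0..T}" for t
    proof -
      let ?S = "{min (X t k) (X t \<kappa>)..max (X t k) (X t \<kappa>)}"
      have S: "?S \<subseteq> {a..b}" using X_ab[of t] t by auto
      have "norm ((g (X t \<kappa>) - g' (X t k) * X t \<kappa>) - (g (X t k) - g' (X t k) * X t k)) \<le>
          \<eta> * norm (X t \<kappa> - X t k)"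
      proof (rule field_differentiable_bound[of ?S "\<lambda>z. g z - g' (X t k) * z" "\<lambda>z. g' z - g' (X t k)"])
        fix z assume z: "z \<in> ?S"
        then have "(g has_real_derivative g' z) (at z within ?S)"
          using S ab g_deriv by (blast intro: has_field_derivative_at_within)
        then show "((\<lambda>z. g z - g' (X t k) * z) has_real_derivative g' z - g' (X t k)) (at z within ?S)"
          by (auto intro!: derivative_eq_intros)
        have "\<bar>z - X t k\<bar> \<le> \<bar>D t\<bar>" using z by (auto simp: D_def)
        then show "norm (g' z - g' (X t k)) \<le> \<eta>"
          using d0[of z "X t k"] D_small[OF t] S z X_ab[of t] t by force
      qed auto
      then show ?thesis by (simp add: R_def D_def algebra_simps)
    qed
    \<comment> \<open>Variation of constants: since \<open>Y\<close> solves the linearised equation,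
      dividing by it leaves only the remainder \<open>R\<close> in the derivative.\<close>
    define Z where "Z t = D t / Y t k" for t
    have Z: "(Z has_real_derivative R t / Y t k) (at t within {0..T})" if "t \<in> {0..T}" for t
    proof (rule DERIV_subset[of _ _ _ "{0..}"])
      show "(Z has_real_derivative R t / Y t k) (at t within {0..})"
        unfolding Z_def D_def using that \<open>k \<in> K\<close> \<open>\<kappa> \<in> K\<close> Y_pos[of t k]
        by (auto intro!: derivative_eq_intros X_deriv Y_deriv simp: R_def D_def field_simps)
    qed auto
    have "norm (Z T - Z 0) \<le> (\<eta> * (exp (M * T) * \<bar>\<kappa> - k\<bar>) * C) * norm (T - 0)"
    proof (rule field_differentiable_bound[OF _ Z])
      fix t assume t: "t \<in> {0..T}"
      have "\<bar>R t\<bar> \<le> \<eta> * (exp (M * T) * \<bar>\<kappa> - k\<bar>)"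
        by (rule order_trans[OF R[OF t]]) (use D_le[OF t] \<open>\<eta> > 0\<close> in simp)
      then have "\<bar>R t\<bar> * \<bar>inverse (Y t k)\<bar> \<le> \<eta> * (exp (M * T) * \<bar>\<kappa> - k\<bar>) * C"
        by (rule mult_mono) (use C[OF t] \<open>\<eta> > 0\<close> in auto)
      then show "norm (R t / Y t k) \<le> \<eta> * (exp (M * T) * \<bar>\<kappa> - k\<bar>) * C"
        by (simp add: divide_inverse abs_mult)
    qed (use \<open>T \<ge> 0\<close> in auto)
    moreover have "Z 0 = \<kappa> - k" using X_0 \<open>k \<in> K\<close> \<open>\<kappa> \<in> K\<close> by (simp add: Z_def D_def Y_0)
    moreover have "X T \<kappa> - X T k - Y T k * (\<kappa> - k) = Y T k * (Z T - (\<kappa> - k))"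
    proof -
      have "Y T k * Z T = X T \<kappa> - X T k" using Y_pos[of T k] by (simp add: Z_def D_def)
      then show ?thesis by (simp add: right_diff_distrib)
    qed
    ultimately have "norm (X T \<kappa> - X T k - Y T k * (\<kappa> - k)) \<le>
        Y T k * ((\<eta> * (exp (M * T) * \<bar>\<kappa> - k\<bar>) * C) * T)"
      using Y_pos[of T k] \<open>T \<ge> 0\<close> by (simp add: abs_mult)
    also have "\<dots> = Q * \<eta> * \<bar>\<kappa> - k\<bar>" by (simp add: Q_def)
    also have "\<dots> \<le> e * \<bar>\<kappa> - k\<bar>" using Q\<eta> by (rule mult_right_mono) simp
    finally show "norm (X T \<kappa> - X T k - Y T k * (\<kappa> - k)) \<le> e * norm (\<kappa> - k)" by simp
  qed
qed

section \<open>Functions evaluated along trajectories\<close>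

lemma along_deriv:
  assumes "k \<in> K" "t \<ge> 0" "(F has_real_derivative d) (at (X t k))"
  shows "((\<lambda>t. F (X t k)) has_real_derivative d * g (X t k)) (at t within {0..})"
  by (rule DERIV_chain2[OF assms(3) X_deriv[OF assms(1,2)]])

lemma along_cont:
  fixes F :: "real \<Rightarrow> real"
  assumes "k \<in> K" "continuous_on K F"
  shows "continuous_on {0..} (\<lambda>t. F (X t k))"
  by (rule continuous_on_compose2[OF assms(2) X_cont]) (use assms X_in in auto)

text \<open>The trajectory never leaves the compact segment between \<open>k\<close> and
  \<open>kbar\<close>, so \<open>F\<close> need not be bounded on all of \<open>K\<close>.\<close>

lemma along_bounded:
  fixes F :: "real \<Rightarrow> real"
  assumes "k \<in> K" "continuous_on K F"
  obtains B where "\<And>t. t \<ge> 0 \<Longrightarrow> \<bar>F (X t k)\<bar> \<le> B"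
proof -
  let ?I = "{min k kbar..max k kbar}"
  have "min k kbar \<in> K" "max k kbar \<in> K" using kbar_in \<open>k \<in> K\<close> by (auto simp: min_def max_def)
  then have "?I \<subseteq> K" by (rule is_interval_Icc_subset[OF interval_K])
  then have "bounded (F ` ?I)"
    by (intro compact_imp_bounded compact_continuous_image continuous_on_subset[OF assms(2)]) auto
  then obtain B where "\<And>z. z \<in> ?I \<Longrightarrow> \<bar>F z\<bar> \<le> B"
    by (metis bounded_iff imageI real_norm_def)
  moreover have "X t k \<in> ?I" if "t \<ge> 0" for t
    by (rule X_between) (use \<open>k \<in> K\<close> that in auto)
  ultimately show ?thesis using that by blast
qed

lemma along_lim:
  fixes F :: "real \<Rightarrow> real"
  assumes "k \<in> K" "continuous_on K F"
  shows "((\<lambda>t. F (X t k)) \<longlongrightarrow> F kbar) at_top"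
proof (rule isCont_tendsto_compose[OF _ X_lim])
  show "isCont F kbar" using assms(2) open_K kbar_in continuous_on_eq_continuous_at by blast
qed fact

end

section \<open>The value of a convergent strategy\<close>

lemma C1_differentiable_on_realD:
  fixes F :: "real \<Rightarrow> real"
  assumes "F C1_differentiable_on S"
  shows "\<And>x. x \<in> S \<Longrightarrow> (F has_real_derivative deriv F x) (at x)" and "continuous_on S (deriv F)"
proof -
  obtain D where D: "\<And>x. x \<in> S \<Longrightarrow> (F has_real_derivative D x) (at x)" "continuous_on S D"
    using assms by (auto simp: C1_differentiable_on_def has_real_derivative_iff_has_vector_derivative)
  have "deriv F x = D x" if "x \<in> S" for x
    using D(1)[OF that] by (rule DERIV_imp_deriv)
  then show "\<And>x. x \<in> S \<Longrightarrow> (F has_real_derivative deriv F x) (at x)" "continuous_on S (deriv F)"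
    using D by (simp_all cong: continuous_on_cong)
qed

text \<open>The derivative at \<open>s\<close> is \<open>1 / s - p\<close>, which vanishes at an
  interior maximum. Conversely, \<open>ln x < x - 1\<close> for positive
  \<open>x \<noteq> 1\<close>, taken at \<open>x = c / s\<close>, makes the maximum strict and hence
  unique.\<close>

lemma arg_max_ln_minus_linear_iff:
  fixes s p :: real
  assumes "s > 0"
  shows "{c. is_arg_max (\<lambda>c. ln c - ln s + (s - c) * p) (\<lambda>c. c > 0) c} = {s} \<longleftrightarrow> p = 1 / s"
    (is "{c. is_arg_max ?P _ c} = {s} \<longleftrightarrow> _")
proof
  assume "{c. is_arg_max ?P (\<lambda>c. c > 0) c} = {s}"
  then have max: "?P c \<le> ?P s" if "c > 0" for c
  proof -
    have "is_arg_max ?P (\<lambda>c. c > 0) s" using \<open>_ = {s}\<close> by blast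
    then show ?thesis using that by (auto simp: is_arg_max_def simp flip: not_less)
  qed
  have "(?P has_real_derivative 1 / s - p) (at s)"
    using assms by (auto intro!: derivative_eq_intros)
  moreover have "\<forall>y. \<bar>s - y\<bar> < s \<longrightarrow> ?P y \<le> ?P s"
    using max by (auto simp: abs_less_iff)
  ultimately have "1 / s - p = 0" using assms by (intro DERIV_local_max)
  then show "p = 1 / s" by simp
next
  assume p: "p = 1 / s"
  have less: "?P c < ?P s" if "c > 0" "c \<noteq> s" for c
  proof -
    have "ln (c / s) \<le> c / s - 1" "ln (c / s) \<noteq> c / s - 1"
      using ln_le_minus_one[of "c / s"] ln_eq_minus_one[of "c / s"] that assms by auto
    then show ?thesis using that assms by (simp add: p ln_div field_simps)
  qed
  then have "is_arg_max ?P (\<lambda>c. c > 0) c \<longleftrightarrow> c = s" for c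
    using assms by (fastforce simp: is_arg_max_def)
  then show "{c. is_arg_max ?P (\<lambda>c. c > 0) c} = {s}" by auto
qed

section \<open>Equilibrium as a first-order condition\<close>

locale convergent_strategy =
  fixes \<pi> \<delta> \<rho> :: real and f :: "real \<Rightarrow> real" and K :: "real set" and kbar :: real
    and \<sigma> :: "real \<Rightarrow> real"
  assumes \<pi>_pos: "\<pi> > 0" and \<delta>_pos: "\<delta> > 0" and \<rho>_pos: "\<rho> > 0" and nonresonant: "\<pi> + \<delta> \<noteq> \<rho>"
    and K_open: "open K" and K_interval: "is_interval K" and kbar_in_K: "kbar \<in> K"
    and f_C1: "f C1_differentiable_on K"
    and strategy: "strategy K \<sigma>" and converges: "converges_to f K \<sigma> kbar"
begin

abbreviation X :: "real \<Rightarrow> real \<Rightarrow> real" where "X \<equiv> flow f K \<sigma>"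

lemma \<sigma>_pos: "k \<in> K \<Longrightarrow> \<sigma> k > 0"
  and \<sigma>_C1: "\<sigma> C1_differentiable_on K"
  using strategy by (auto simp: strategy_def)

lemma trajectory_X: "k \<in> K \<Longrightarrow> trajectory f K \<sigma> k (\<lambda>t. X t k)"
  unfolding flow_def using converges by (simp add: converges_to_def someI_ex)

sublocale convergent_flow K "\<lambda>k. f k - \<sigma> k" "\<lambda>k. deriv f k - deriv \<sigma> k" X kbar
proof
  show "((\<lambda>k. f k - \<sigma> k) has_real_derivative deriv f z - deriv \<sigma> z) (at z)" if "z \<in> K" for z
    by (intro DERIV_diff C1_differentiable_on_realD(1)[OF f_C1] C1_differentiable_on_realD(1)[OF \<sigma>_C1] that)
  show "continuous_on K (\<lambda>k. deriv f k - deriv \<sigma> k)"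
    by (intro continuous_on_diff C1_differentiable_on_realD(2) f_C1 \<sigma>_C1)
qed (use K_open K_interval kbar_in_K converges trajectory_X in
      \<open>auto simp: trajectory_def converges_to_def\<close>)

lemma ln_\<sigma>_deriv: "k \<in> K \<Longrightarrow> ((\<lambda>k. ln (\<sigma> k)) has_real_derivative deriv \<sigma> k / \<sigma> k) (at k)"
  using \<sigma>_pos[of k]
  by (auto intro!: derivative_eq_intros C1_differentiable_on_realD(1)[OF \<sigma>_C1] simp: divide_inverse)

lemma ln_\<sigma>_cont: "continuous_on K (\<lambda>k. ln (\<sigma> k))"
  by (rule DERIV_continuous_on[OF has_field_derivative_at_within[OF ln_\<sigma>_deriv]])

text \<open>A multiple of \<open>Y\<close> shows that the choice in the definition is made from a
  nonempty set; uniqueness then determines the chosen solution on nonnegative times.\<close>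

lemma linearised_solution_eq:
  assumes "k \<in> K" "t \<ge> 0"
  shows "linearised_solution f K \<sigma> k c t = (\<sigma> k - c) * Y t k"
proof -
  define Q where "Q y \<longleftrightarrow> y 0 = \<sigma> k - c \<and> (\<forall>t\<ge>0. (y has_real_derivative
      ((deriv f (X t k) - deriv \<sigma> (X t k)) * y t)) (at t within {0..}))" for y
  have "Q (\<lambda>t. (\<sigma> k - c) * Y t k)"
    unfolding Q_def using DERIV_cmult[OF Y_deriv[OF \<open>k \<in> K\<close>], of _ "\<sigma> k - c"]
    by (simp add: Y_0 mult.left_commute)
  moreover have "linearised_solution f K \<sigma> k c = (SOME y. Q y)"
    by (simp only: linearised_solution_def Q_def)
  ultimately have "Q (linearised_solution f K \<sigma> k c)"
    by (simp only: someI[of Q])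
  then show ?thesis
    using linearised_unique[OF assms, of "linearised_solution f K \<sigma> k c"] by (simp add: Q_def)
qed

lemma v_integrand_deriv:
  assumes "k \<in> K" "t \<ge> 0"
  shows "deriv (\<lambda>\<kappa>. v_integrand \<pi> \<delta> \<rho> f K \<sigma> \<kappa> t) k =
    discount \<pi> \<delta> \<rho> t * (deriv \<sigma> (X t k) / \<sigma> (X t k)) * Y t k"
  unfolding v_integrand_def mult.assoc
  by (intro DERIV_imp_deriv DERIV_cmult DERIV_chain2[OF ln_\<sigma>_deriv X_deriv_initial] X_in assms)

text \<open>The linearised solution and the derivative of the flow in \<open>k\<close> are both
  multiples of \<open>Y\<close>. So the integrand of \<open>P1\<close> is
  \<open>\<sigma> k - c\<close> times the \<open>k\<close>-derivative of \<open>v_integrand\<close>,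
  whose integral is the derivative of \<open>v_integral\<close>.\<close>

lemma P1_eq:
  assumes "differentiable_under_integral K (v_integrand \<pi> \<delta> \<rho> f K \<sigma>)" "k \<in> K"
  shows "P1 \<pi> \<delta> \<rho> f K k \<sigma> c =
    ln c - ln (\<sigma> k) + (\<sigma> k - c) * deriv (v_integral \<pi> \<delta> \<rho> f K \<sigma>) k"
proof -
  let ?D = "\<lambda>t. deriv (\<lambda>\<kappa>. v_integrand \<pi> \<delta> \<rho> f K \<sigma> \<kappa> t) k"
  have "(v_integral \<pi> \<delta> \<rho> f K \<sigma> has_real_derivative integral {0..} ?D) (at k)"
    using assms by (simp add: differentiable_under_integral_def v_integral_def[abs_def])
  then have "deriv (v_integral \<pi> \<delta> \<rho> f K \<sigma>) k = integral {0..} ?D"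
    by (rule DERIV_imp_deriv)
  moreover have "integral {0..} (\<lambda>t. discount \<pi> \<delta> \<rho> t * (deriv \<sigma> (X t k) / \<sigma> (X t k))
       * linearised_solution f K \<sigma> k c t) = integral {0..} (\<lambda>t. (\<sigma> k - c) * ?D t)"
    by (intro integral_cong)
      (simp add: v_integrand_deriv linearised_solution_eq \<open>k \<in> K\<close> mult.commute mult.left_commute)
  ultimately show ?thesis by (simp add: P1_def)
qed

lemma equilibrium_iff:
  assumes "differentiable_under_integral K (v_integrand \<pi> \<delta> \<rho> f K \<sigma>)"
  shows "equilibrium_strategy \<pi> \<delta> \<rho> f K kbar \<sigma> \<longleftrightarrow>
    (\<forall>k\<in>K. deriv (v_integral \<pi> \<delta> \<rho> f K \<sigma>) k = 1 / \<sigma> k)"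
proof -
  have "P1 \<pi> \<delta> \<rho> f K k \<sigma> =
      (\<lambda>c. ln c - ln (\<sigma> k) + (\<sigma> k - c) * deriv (v_integral \<pi> \<delta> \<rho> f K \<sigma>) k)" if "k \<in> K" for k
    using P1_eq[OF assms that] by auto
  then show ?thesis
    using strategy converges arg_max_ln_minus_linear_iff[OF \<sigma>_pos]
    by (simp add: equilibrium_strategy_def)
qed

section \<open>Exponentially discounted integrals along trajectories\<close>

definition J :: "real \<Rightarrow> real \<Rightarrow> real" where
  "J a k = integral {0..} (\<lambda>t. exp (- a * t) * ln (\<sigma> (X t k)))"

lemma J_integrand_integrable:
  assumes "a > 0" "k \<in> K"
  shows "(\<lambda>t. exp (- a * t) * ln (\<sigma> (X t k))) integrable_on {0..}"
proof -
  obtain B where "\<And>t. t \<ge> 0 \<Longrightarrow> \<bar>ln (\<sigma> (X t k))\<bar> \<le> B"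
    using along_bounded[OF \<open>k \<in> K\<close> ln_\<sigma>_cont] by metis
  from discounted_integrable[OF \<open>a > 0\<close> along_cont[OF \<open>k \<in> K\<close> ln_\<sigma>_cont] this]
  show ?thesis using set_lebesgue_integral_eq_integral(1) by blast
qed

text \<open>By the semigroup property, moving the initial value along the flow shifts the integrand
  in time. Only the derivative in the direction of the flow is obtained, without presupposing that
  \<open>J a\<close> is differentiable in \<open>k\<close>.\<close>

lemma J_deriv_along:
  assumes "a > 0" "k \<in> K"
  shows "((\<lambda>s. J a (X s k)) has_real_derivative a * J a k - ln (\<sigma> k)) (at 0 within {0..})"
proof (rule has_field_derivative_transform_within)
  obtain B where B: "\<And>t. t \<ge> 0 \<Longrightarrow> \<bar>ln (\<sigma> (X t k))\<bar> \<le> B"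
    using along_bounded[OF \<open>k \<in> K\<close> ln_\<sigma>_cont] by metis
  from discounted_integral_shift_derivative[OF \<open>a > 0\<close> along_cont[OF \<open>k \<in> K\<close> ln_\<sigma>_cont] B]
  show "((\<lambda>s. integral {0..} (\<lambda>t. exp (- a * t) * ln (\<sigma> (X (t + s) k))))
      has_real_derivative a * J a k - ln (\<sigma> k)) (at 0 within {0..})"
    using X_0[OF \<open>k \<in> K\<close>] by (simp add: J_def)
  show "integral {0..} (\<lambda>t. exp (- a * t) * ln (\<sigma> (X (t + s) k))) = J a (X s k)" if "s \<in> {0..}" for s
    unfolding J_def by (rule integral_cong) (use X_add \<open>k \<in> K\<close> that in auto)
qed (auto intro: zero_less_one)

text \<open>The trajectory rests at \<open>kbar\<close>, and \<open>g_kbar\<close> gives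
  \<open>\<sigma> kbar = f kbar\<close>, so the logarithm is a constant factor.\<close>

lemma J_kbar:
  assumes "a > 0"
  shows "J a kbar = ln (f kbar) / a"
proof -
  have "J a kbar = integral {0..} (\<lambda>t. ln (\<sigma> kbar) * exp (- a * t))"
    unfolding J_def by (rule integral_cong) (simp add: X_kbar)
  also have "\<dots> = ln (\<sigma> kbar) * (1 / a)"
    using integral_unique[OF has_integral_exp_minus_to_infinity[OF assms, of 0]] by simp
  finally show ?thesis using g_kbar by simp
qed

text \<open>Continuity of \<open>F\<close> at \<open>kbar\<close> makes \<open>F (X t k)\<close>
  converge, which singles it out among the solutions of the scalar equation.\<close>

lemma J_eq_if_deriv_along:
  assumes "a > 0" "k \<in> K" and F: "continuous_on K F"
    and deriv: "\<And>t. t \<ge> 0 \<Longrightarrow> ((\<lambda>t. F (X t k)) has_real_derivative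
      (a * F (X t k) - ln (\<sigma> (X t k)))) (at t within {0..})"
  shows "J a k = F k"
proof -
  obtain B where B: "\<And>t. t \<ge> 0 \<Longrightarrow> \<bar>ln (\<sigma> (X t k))\<bar> \<le> B"
    using along_bounded[OF \<open>k \<in> K\<close> ln_\<sigma>_cont] by metis
  have "J a k = F (X 0 k)"
    unfolding J_def
    by (rule discounted_integral_eq_if_convergent_solution[OF \<open>a > 0\<close> along_cont[OF \<open>k \<in> K\<close> ln_\<sigma>_cont] B
          deriv along_lim[OF \<open>k \<in> K\<close> F]])
  then show ?thesis by (simp add: X_0 \<open>k \<in> K\<close>)
qed

lemma v_integral_eq:
  assumes "k \<in> K"
  shows "v_integral \<pi> \<delta> \<rho> f K \<sigma> k = ((\<delta> - \<rho>) * J (\<delta> + \<pi>) k + \<pi> * J \<rho> k) / (\<pi> + \<delta> - \<rho>)"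
proof -
  have "v_integral \<pi> \<delta> \<rho> f K \<sigma> k = integral {0..} (\<lambda>t.
      (\<delta> - \<rho>) / (\<pi> + \<delta> - \<rho>) * (exp (- (\<delta> + \<pi>) * t) * ln (\<sigma> (X t k))) +
      \<pi> / (\<pi> + \<delta> - \<rho>) * (exp (- \<rho> * t) * ln (\<sigma> (X t k))))"
    unfolding v_integral_def v_integrand_def[abs_def] discount_def by (simp add: algebra_simps)
  also have "\<dots> = (\<delta> - \<rho>) / (\<pi> + \<delta> - \<rho>) * J (\<delta> + \<pi>) k + \<pi> / (\<pi> + \<delta> - \<rho>) * J \<rho> k"
    unfolding J_def
    by (subst integral_add)
      (simp_all only: integral_mult_right integrable_on_mult_right
        J_integrand_integrable[OF _ assms] \<pi>_pos \<delta>_pos \<rho>_pos add_pos_pos)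
  finally show ?thesis by (simp add: add_divide_distrib)
qed

lemma w_integral_eq:
  assumes "k \<in> K"
  shows "w_integral \<pi> \<delta> \<rho> f K \<sigma> k = \<pi> / (\<pi> + \<delta> - \<rho>) * (J \<rho> k - J (\<delta> + \<pi>) k)"
proof -
  have "integral {0..} (w_integrand \<pi> \<delta> \<rho> f K \<sigma> k) = integral {0..} (\<lambda>t.
      exp (- \<rho> * t) * ln (\<sigma> (X t k)) - exp (- (\<delta> + \<pi>) * t) * ln (\<sigma> (X t k)))"
    unfolding w_integrand_def[abs_def] by (simp add: algebra_simps)
  also have "\<dots> = J \<rho> k - J (\<delta> + \<pi>) k"
    unfolding J_def
    by (rule integral_diff)
      (simp_all only: J_integrand_integrable[OF _ assms] \<pi>_pos \<delta>_pos \<rho>_pos add_pos_pos)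
  finally show ?thesis by (simp add: w_integral_def)
qed

text \<open>The trajectory is only defined for nonnegative times, so the chain rule is applied to
  one-sided derivatives at time \<open>0\<close>.\<close>

lemma deriv_mult_g_eq:
  assumes "k \<in> K" and F: "(F has_real_derivative F') (at k)"
    and eq: "\<And>k. k \<in> K \<Longrightarrow> F k = p * J (\<delta> + \<pi>) k + q * J \<rho> k"
  shows "F' * (f k - \<sigma> k) = p * ((\<delta> + \<pi>) * J (\<delta> + \<pi>) k - ln (\<sigma> k)) + q * (\<rho> * J \<rho> k - ln (\<sigma> k))"
proof (rule has_field_derivative_unique)
  show "((\<lambda>t. F (X t k)) has_real_derivative F' * (f k - \<sigma> k)) (at 0 within {0..})"
    using along_deriv[OF \<open>k \<in> K\<close>, of 0 F F'] F X_0[OF \<open>k \<in> K\<close>] by simp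
  have "((\<lambda>t. p * J (\<delta> + \<pi>) (X t k) + q * J \<rho> (X t k)) has_real_derivative
      p * ((\<delta> + \<pi>) * J (\<delta> + \<pi>) k - ln (\<sigma> k)) + q * (\<rho> * J \<rho> k - ln (\<sigma> k))) (at 0 within {0..})"
    by (intro DERIV_add DERIV_cmult J_deriv_along) (use \<open>k \<in> K\<close> \<pi>_pos \<delta>_pos \<rho>_pos in auto)
  then show "((\<lambda>t. F (X t k)) has_real_derivative
      p * ((\<delta> + \<pi>) * J (\<delta> + \<pi>) k - ln (\<sigma> k)) + q * (\<rho> * J \<rho> k - ln (\<sigma> k))) (at 0 within {0..})"
    by (rule has_field_derivative_transform_within[OF _ zero_less_one])
      (use eq X_in \<open>k \<in> K\<close> in auto)
  \<comment> \<open>A one-sided derivative at 0 is unique because 0 is a limit point of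
    \<open>{0..}\<close>.\<close>
  have "at_right (0::real) \<le> at 0 within {0..}" by (rule at_le) auto
  then show "at 0 within {0::real..} \<noteq> bot"
    using trivial_limit_at_right_real[of "0::real"] by (metis bot.extremum_uniqueI)
qed

section \<open>Boundary conditions and the differential system\<close>

lemma boundary: "boundary_B \<pi> \<delta> \<rho> f kbar (v_integral \<pi> \<delta> \<rho> f K \<sigma>) (w_integral \<pi> \<delta> \<rho> f K \<sigma>)"
proof -
  have "\<pi> + \<delta> - \<rho> \<noteq> 0" "\<delta> + \<pi> \<noteq> 0" "\<rho> \<noteq> 0" using \<pi>_pos \<delta>_pos \<rho>_pos nonresonant by auto
  then show ?thesis
    using \<pi>_pos \<delta>_pos \<rho>_pos unfolding boundary_B_def
    by (simp add: v_integral_eq w_integral_eq kbar_in_K J_kbar divide_simps) (simp add: algebra_simps)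
qed

text \<open>Since \<open>1 / v' = \<sigma>\<close>, the left-hand sides of the system are
  derivatives along the flow, up to the term \<open>ln (\<sigma> k)\<close>. They are known in terms
  of \<open>J (\<delta> + \<pi>)\<close> and \<open>J \<rho>\<close>, which are then expressed
  through \<open>v\<close> and \<open>w\<close>.\<close>

lemma system_if_equilibrium:
  assumes v: "differentiable_under_integral K (v_integrand \<pi> \<delta> \<rho> f K \<sigma>)"
    and w: "differentiable_under_integral K (w_integrand \<pi> \<delta> \<rho> f K \<sigma>)"
    and eq: "\<And>k. k \<in> K \<Longrightarrow> deriv (v_integral \<pi> \<delta> \<rho> f K \<sigma>) k = 1 / \<sigma> k"
  shows "system_S \<pi> \<delta> \<rho> f K (v_integral \<pi> \<delta> \<rho> f K \<sigma>) (w_integral \<pi> \<delta> \<rho> f K \<sigma>)"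
  unfolding system_S_def
proof (intro ballI)
  let ?v = "v_integral \<pi> \<delta> \<rho> f K \<sigma>" and ?w = "w_integral \<pi> \<delta> \<rho> f K \<sigma>"
  fix k assume k: "k \<in> K"
  \<comment> \<open>\<open>D\<close> is the common denominator. All identities are multiplied by it,
    so that what remains is polynomial.\<close>
  define A B D where "A = J (\<delta> + \<pi>) k" and "B = J \<rho> k" and "D = \<pi> + \<delta> - \<rho>"
  have "D \<noteq> 0" using nonresonant by (simp add: D_def)
  then have cancel: "D * (p / D * x + q / D * y) = p * x + q * y" for p q x y :: real
    by (simp add: distrib_left)
  have v_diff: "?v field_differentiable at k"
    using v k by (auto simp: differentiable_under_integral_def v_integral_def[abs_def] field_differentiable_def)
  have "(\<lambda>\<kappa>. integral {0..} (w_integrand \<pi> \<delta> \<rho> f K \<sigma> \<kappa>)) field_differentiable at k"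
    using w k by (auto simp: differentiable_under_integral_def field_differentiable_def)
  then have w_diff: "?w field_differentiable at k"
    unfolding w_integral_def[abs_def] by (intro derivative_intros)
  have "deriv ?v k * (f k - \<sigma> k) = (\<delta> - \<rho>) / D * ((\<delta> + \<pi>) * A - ln (\<sigma> k)) + \<pi> / D * (\<rho> * B - ln (\<sigma> k))"
    unfolding A_def B_def
    by (rule deriv_mult_g_eq[OF k v_diff[THEN DERIV_deriv_iff_field_differentiable[THEN iffD2]]])
      (simp add: v_integral_eq D_def add_divide_distrib)
  then have v': "D * (deriv ?v k * (f k - \<sigma> k)) =
      (\<delta> - \<rho>) * ((\<delta> + \<pi>) * A - ln (\<sigma> k)) + \<pi> * (\<rho> * B - ln (\<sigma> k))"
    by (simp only: cancel)
  have "deriv ?w k * (f k - \<sigma> k) = - \<pi> / D * ((\<delta> + \<pi>) * A - ln (\<sigma> k)) + \<pi> / D * (\<rho> * B - ln (\<sigma> k))"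
    unfolding A_def B_def
    by (rule deriv_mult_g_eq[OF k w_diff[THEN DERIV_deriv_iff_field_differentiable[THEN iffD2]]])
      (simp add: w_integral_eq D_def right_diff_distrib)
  then have w': "D * (deriv ?w k * (f k - \<sigma> k)) =
      - \<pi> * ((\<delta> + \<pi>) * A - ln (\<sigma> k)) + \<pi> * (\<rho> * B - ln (\<sigma> k))"
    by (simp only: cancel)
  have v_eq: "D * ?v k = (\<delta> - \<rho>) * A + \<pi> * B" and w_eq: "D * ?w k = \<pi> * (B - A)"
    using \<open>D \<noteq> 0\<close> by (simp_all add: v_integral_eq w_integral_eq k A_def B_def D_def)
  \<comment> \<open>The logarithms cancel here because their coefficients
    \<open>\<delta> - \<rho>\<close> and \<open>\<pi>\<close> add up to \<open>D\<close>; in the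
    equation for \<open>w\<close> they cancel among themselves.\<close>
  have "D * (deriv ?v k * (f k - \<sigma> k) + ln (\<sigma> k)) = D * (\<delta> * ?v k - (\<delta> - \<rho>) * ?w k)"
    using v' v_eq w_eq D_def by algebra
  then have "deriv ?v k * (f k - \<sigma> k) + ln (\<sigma> k) = \<delta> * ?v k - (\<delta> - \<rho>) * ?w k"
    using \<open>D \<noteq> 0\<close> by simp
  moreover have "D * (deriv ?w k * (f k - \<sigma> k)) = D * (- \<pi> * ?v k + (\<rho> + \<pi>) * ?w k)"
    using w' v_eq w_eq D_def by algebra
  then have "deriv ?w k * (f k - \<sigma> k) = - \<pi> * ?v k + (\<rho> + \<pi>) * ?w k"
    using \<open>D \<noteq> 0\<close> by simp
  ultimately show "?v field_differentiable at k \<and> ?w field_differentiable at k \<and> deriv ?v k > 0 \<and>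
      (f k - 1 / deriv ?v k) * deriv ?v k - ln (deriv ?v k) = \<delta> * ?v k - (\<delta> - \<rho>) * ?w k \<and>
      (f k - 1 / deriv ?v k) * deriv ?w k = - \<pi> * ?v k + (\<rho> + \<pi>) * ?w k"
    using v_diff w_diff \<sigma>_pos[OF k] by (simp add: eq[OF k] ln_div mult.commute)
qed

text \<open>The combinations \<open>v - w\<close> and \<open>v + (\<delta> - \<rho>) / \<pi> * w\<close> decouple the system: along trajectories
  they solve the equations that characterise \<open>J (\<delta> + \<pi>)\<close> and \<open>J \<rho>\<close>.\<close>

lemma v_integral_eq_if_system:
  assumes S: "system_S \<pi> \<delta> \<rho> f K v w" and \<sigma>: "\<And>k. k \<in> K \<Longrightarrow> \<sigma> k = 1 / deriv v k" and k: "k \<in> K"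
  shows "v_integral \<pi> \<delta> \<rho> f K \<sigma> k = v k"
proof -
  have v: "(v has_real_derivative deriv v k) (at k)" and w: "(w has_real_derivative deriv w k) (at k)"
    and v_eq: "deriv v k * (f k - \<sigma> k) = \<delta> * v k - (\<delta> - \<rho>) * w k - ln (\<sigma> k)"
    and w_eq: "deriv w k * (f k - \<sigma> k) = - \<pi> * v k + (\<rho> + \<pi>) * w k" if "k \<in> K" for k
    using S that \<sigma>[OF that]
    by (auto simp: system_S_def DERIV_deriv_iff_field_differentiable ln_div mult.commute)
  have cont: "continuous_on K v" "continuous_on K w"
    by (rule DERIV_continuous_on[OF has_field_derivative_at_within[OF v]]
        DERIV_continuous_on[OF has_field_derivative_at_within[OF w]], assumption)+
  \<comment> \<open>The two conditions on \<open>q\<close> say that \<open>(1, q)\<close> is a left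
    eigenvector, with eigenvalue \<open>a\<close>, of the coefficient matrix of the system. The
    logarithm enters only the equation for \<open>v\<close>, so its coefficient stays
    \<open>-1\<close>. The eigenvalues are \<open>\<delta> + \<pi>\<close> and
    \<open>\<rho>\<close>.\<close>
  have J_eq: "J a k = v k + q * w k" if "a > 0" and a: "\<delta> - q * \<pi> = a" "q * (\<rho> + \<pi>) - (\<delta> - \<rho>) = a * q" for a q
  proof (rule J_eq_if_deriv_along[OF \<open>a > 0\<close> k])
    show "continuous_on K (\<lambda>k. v k + q * w k)" by (intro continuous_intros cont)
    fix t :: real assume "t \<ge> 0"
    let ?x = "X t k"
    have x: "?x \<in> K" using X_in k \<open>t \<ge> 0\<close> by simp
    have "((\<lambda>t. v (X t k) + q * w (X t k)) has_real_derivative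
        (deriv v ?x + q * deriv w ?x) * (f ?x - \<sigma> ?x)) (at t within {0..})"
      by (rule along_deriv[OF k \<open>t \<ge> 0\<close>]) (intro DERIV_add DERIV_cmult v w x)
    moreover have "(deriv v ?x + q * deriv w ?x) * (f ?x - \<sigma> ?x) = a * (v ?x + q * w ?x) - ln (\<sigma> ?x)"
      using v_eq[OF x] w_eq[OF x] a by algebra
    ultimately show "((\<lambda>t. v (X t k) + q * w (X t k)) has_real_derivative
        a * (v ?x + q * w ?x) - ln (\<sigma> ?x)) (at t within {0..})" by simp
  qed
  have "J (\<delta> + \<pi>) k = v k + (- 1) * w k"
    by (rule J_eq) (use \<pi>_pos \<delta>_pos in auto)
  moreover have "J \<rho> k = v k + (\<delta> - \<rho>) / \<pi> * w k"
    by (rule J_eq) (use \<pi>_pos \<rho>_pos in \<open>auto simp: field_simps\<close>)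
  ultimately have "v_integral \<pi> \<delta> \<rho> f K \<sigma> k =
      ((\<delta> - \<rho>) * (v k - w k) + (\<pi> * v k + (\<delta> - \<rho>) * w k)) / (\<pi> + \<delta> - \<rho>)"
    using \<pi>_pos by (simp add: v_integral_eq[OF k] distrib_left)
  also have "\<dots> = v k" using nonresonant by (simp add: divide_simps) (simp add: algebra_simps)
  finally show ?thesis .
qed

text \<open>Once \<open>v\<close> is identified with \<open>v_integral\<close> on \<open>K\<close>,
  the given relation between \<open>\<sigma>\<close> and \<open>v'\<close> is exactly the
  first-order condition.\<close>

lemma equilibrium_if_system:
  assumes "differentiable_under_integral K (v_integrand \<pi> \<delta> \<rho> f K \<sigma>)"
    and S: "system_S \<pi> \<delta> \<rho> f K v w" and \<sigma>: "\<And>k. k \<in> K \<Longrightarrow> \<sigma> k = 1 / deriv v k"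
  shows "equilibrium_strategy \<pi> \<delta> \<rho> f K kbar \<sigma>"
  unfolding equilibrium_iff[OF assms(1)]
proof
  fix k assume k: "k \<in> K"
  \<comment> \<open>Equality on a whole neighbourhood, available because \<open>K\<close> is open,
    is what carries over to derivatives.\<close>
  have "\<forall>\<^sub>F \<kappa> in nhds k. v_integral \<pi> \<delta> \<rho> f K \<sigma> \<kappa> = v \<kappa>"
    using eventually_nhds_in_open[OF K_open k]
    by eventually_elim (rule v_integral_eq_if_system[OF S \<sigma>])
  then have "deriv (v_integral \<pi> \<delta> \<rho> f K \<sigma>) k = deriv v k"
    by (rule deriv_cong_ev) simp
  then show "deriv (v_integral \<pi> \<delta> \<rho> f K \<sigma>) k = 1 / \<sigma> k" by (simp add: \<sigma>[OF k])
qed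

end

theorem proposition4:
  fixes \<pi> \<delta> \<rho> kbar :: real and K :: "real set" and f :: "real \<Rightarrow> real"
  assumes "\<pi> > 0" and "\<delta> > 0" and "\<rho> > 0" and "\<pi> + \<delta> \<noteq> \<rho>"
    and "open K" and "is_interval K" and "kbar \<in> K"
    and "production_function K f"
  shows
    "(\<forall>\<sigma>. strategy K \<sigma> \<and> converges_to f K \<sigma> kbar
        \<and> differentiable_under_integral K (v_integrand \<pi> \<delta> \<rho> f K \<sigma>)
        \<and> differentiable_under_integral K (w_integrand \<pi> \<delta> \<rho> f K \<sigma>)
        \<and> equilibrium_strategy \<pi> \<delta> \<rho> f K kbar \<sigma>
      \<longrightarrow> system_S \<pi> \<delta> \<rho> f K (v_integral \<pi> \<delta> \<rho> f K \<sigma>) (w_integral \<pi> \<delta> \<rho> f K \<sigma>)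
        \<and> boundary_B \<pi> \<delta> \<rho> f kbar (v_integral \<pi> \<delta> \<rho> f K \<sigma>) (w_integral \<pi> \<delta> \<rho> f K \<sigma>)
        \<and> (\<forall>k\<in>K. \<sigma> k = 1 / deriv (v_integral \<pi> \<delta> \<rho> f K \<sigma>) k))
   \<and> (\<forall>v \<sigma>. v C1_differentiable_on K \<and> deriv v C1_differentiable_on K
        \<and> (\<forall>k\<in>K. \<sigma> k = 1 / deriv v k)
        \<and> strategy K \<sigma> \<and> converges_to f K \<sigma> kbar
        \<and> differentiable_under_integral K (v_integrand \<pi> \<delta> \<rho> f K \<sigma>)
        \<and> (\<exists>w. w C1_differentiable_on K \<and> system_S \<pi> \<delta> \<rho> f K v w
              \<and> boundary_B \<pi> \<delta> \<rho> f kbar v w)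
      \<longrightarrow> equilibrium_strategy \<pi> \<delta> \<rho> f K kbar \<sigma>)"
proof -
  have conv: "convergent_strategy \<pi> \<delta> \<rho> f K kbar \<sigma>"
    if "strategy K \<sigma>" "converges_to f K \<sigma> kbar" for \<sigma>
    using assms that by unfold_locales (auto simp: production_function_def)
  show ?thesis
  proof (intro conjI allI impI; elim conjE exE)
    fix \<sigma>
    assume \<sigma>: "strategy K \<sigma>" "converges_to f K \<sigma> kbar"
      and v: "differentiable_under_integral K (v_integrand \<pi> \<delta> \<rho> f K \<sigma>)"
      and w: "differentiable_under_integral K (w_integrand \<pi> \<delta> \<rho> f K \<sigma>)"
      and eq: "equilibrium_strategy \<pi> \<delta> \<rho> f K kbar \<sigma>"
    interpret convergent_strategy \<pi> \<delta> \<rho> f K kbar \<sigma> by (rule conv[OF \<sigma>])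
    have v': "deriv (v_integral \<pi> \<delta> \<rho> f K \<sigma>) k = 1 / \<sigma> k" if "k \<in> K" for k
      using eq equilibrium_iff[OF v] that by simp
    show "system_S \<pi> \<delta> \<rho> f K (v_integral \<pi> \<delta> \<rho> f K \<sigma>) (w_integral \<pi> \<delta> \<rho> f K \<sigma>)"
      by (rule system_if_equilibrium[OF v w v'])
    show "boundary_B \<pi> \<delta> \<rho> f kbar (v_integral \<pi> \<delta> \<rho> f K \<sigma>) (w_integral \<pi> \<delta> \<rho> f K \<sigma>)"
      by (rule boundary)
    show "\<forall>k\<in>K. \<sigma> k = 1 / deriv (v_integral \<pi> \<delta> \<rho> f K \<sigma>) k"
      by (simp add: v')
  next
    fix v \<sigma> w
    assume "strategy K \<sigma>" "converges_to f K \<sigma> kbar"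
      and "differentiable_under_integral K (v_integrand \<pi> \<delta> \<rho> f K \<sigma>)"
      and "system_S \<pi> \<delta> \<rho> f K v w" "\<forall>k\<in>K. \<sigma> k = 1 / deriv v k"
    then show "equilibrium_strategy \<pi> \<delta> \<rho> f K kbar \<sigma>"
      using convergent_strategy.equilibrium_if_system[OF conv] by blast
  qed
qed

end
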